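(* Let $y=(y_1,\dots,y_r)\in\mathcal V_r$ with $y_i=(v_i^t\mathbf x)^d$, $v_i\in\mathbb C^n\setminus\{0\}$. The Gauss–Newton equation $$(DF(y))^*\circ(DF(y))[\eta]=-(DF(y))^*[F(y)],\qquad \eta\in T_y\mathcal V_r,$$ in the orthonormal basis $Q$ of $T_y\mathcal V_r$ (defined in the context) is of the form $H\tilde\eta=-G$, where $\tilde\eta^t=(\tilde\eta_1^t,\dots,\tilde\eta_r^t)\in\mathbb R^{2nr}$ is the unknown coordinate vector of an element of $T_y\mathcal V_r$ in the basis $Q$ and - $G=[G_k]_{k=1,\dots,2nr}$ with, for $1\le i\le r$, $1\le j\le2n$, $$G_{2n(i-1)+j}=\sqrt{d^{-1}}\,\|v_i\|^{-d+1}\Big(d\sum_{k=1}^r\Re\big((u_{i,j}^*v_k)(v_i^*v_k)^{d-1}\big)-\Re\big(u_{i,j}^*\nabla_{\mathbf x}\mathbf p(\overline{v_i})\big)\Big),$$ - $H=[H_{k,k'}]_{1\le k,k'\le2nr}$ with, for $1\le i,i'\le r$, $1\le j,j'\le2n$, $$H_{2n(i-1)+j,\,2n(i'-1)+j'}=\|v_i\|^{-d+1}\|v_{i'}\|^{-d+1}\Big(\Re\big((u_{i,j}^*u_{i',j'})(v_i^*v_{i'})^{d-1}\big)+(d-1)\Re\big((u_{i,j}^*v_{i'})(v_i^*u_{i',j'})(v_i^*v_{i'})^{d-2}\big)\Big).$$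
   Context: $\mathbb C[\mathbf x]_d$ is the space of homogeneous polynomials of degree $d$ in $\mathbf x=(x_1,\dots,x_n)$. Writing $\mathbf p=\sum_{|\alpha|=d}\binom d\alpha p_\alpha\mathbf x^\alpha$, $\mathbf q=\sum_{|\alpha|=d}\binom d\alpha q_\alpha\mathbf x^\alpha$, the apolar product is $\langle\mathbf p,\mathbf q\rangle_d=\sum_{|\alpha|=d}\binom d\alpha\bar p_\alpha q_\alpha$, and $\langle\mathbf p,\mathbf q\rangle_d^{\mathbb R}=\Re\langle\mathbf p,\mathbf q\rangle_d$ is a real inner product on the $\mathbb R$-vector space $\mathbb C[\mathbf x]_d$. Standing assumptions: $d>2$ and $r<r_g$, where $r_g=\lceil\frac1n\binom{n+d-1}{d}\rceil$ is the generic symmetric rank, increased by $1$ for $(d,n)\in\{(3,5),(4,3),(4,4),(4,5)\}$. A polynomial $\mathbf p\in\mathbb C[\mathbf x]_d$ is fixed. ${}^t$ is transpose and, on vectors, ${}^*$ is conjugate transpose. The Veronese manifold is $\mathcal V^{n,d}=\{(v^t\mathbf x)^d:v\in\mathbb C^n\setminus\{0\}\}$, a real manifold with tangent space $T_{(v^t\mathbf x)^d}\mathcal V^{n,d}=\{(u^t\mathbf x)(v^t\mathbf x)^{d-1}:u\in\mathbb C^n\}$ of real dimension $2n$, and metric $\langle\cdot,\cdot\rangle_d^{\mathbb R}$. $\mathcal V_r=\mathcal V^{n,d}\times\cdots\times\mathcal V^{n,d}$ ($r$ factors), with the inner product on $T_y\mathcal V_r=\prod_iT_{y_i}\mathcal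 V^{n,d}$ induced by $\langle\cdot,\cdot\rangle_d^{\mathbb R}$ on each component. $F:\mathcal V_r\to\mathbb C[\mathbf x]_d$, $F(y)=y_1+\cdots+y_r-\mathbf p$, so that $DF(y)(\eta_1,\dots,\eta_r)=\eta_1+\cdots+\eta_r$; $(DF(y))^*$ is the adjoint of $DF(y):T_y\mathcal V_r\to\mathbb C[\mathbf x]_d$ for these real inner products. **The basis $Q$.** For $v\in\mathbb C^n\setminus\{0\}$ let $\langle u,u'\rangle_v=\Re(u^*u'+(d-1)(u^*v)(v^*u')\|v\|^{-2})$, a real inner product on $\mathbb C^n\sim\mathbb R^{2n}$. For each $i$, $u_{i,1},\dots,u_{i,2n}\in\mathbb C^n$ is an orthonormal $\mathbb R$-basis for $\langle\cdot,\cdot\rangle_{v_i}$ with $u_{i,1}=\frac{v_i}{\sqrt d\|v_i\|}$, and $\mathbf q_{i,j}=\sqrt d\,\|v_i\|^{-d+1}(u_{i,j}^t\mathbf x)(v_i^t\mathbf x)^{d-1}$, $j=1,\dots,2n$, is the associated orthonormal basis of $T_{y_i}\mathcal V^{n,d}$. The basis $Q$ of $T_y\mathcal V_r$ consists of the vectors having $\mathbf q_{i,j}$ as $i$-th component and $0$ elsewhere, with $(i,j)$ at position $2n(i-1)+j$. *)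

theory Defs
  imports "HOL-Analysis.Analysis" "HOL-Analysis.Finite_Function_Topology"
begin

text \<open>Polynomials in the variables \<open>x\<^sub>i\<close>, \<open>i :: 'n\<close>, are finitely supported maps from exponent
  vectors to coefficients, with the convolution product of \<open>HOL-Library.Poly_Mapping\<close>;
  \<open>HOL-Analysis.Finite_Function_Topology\<close> makes them a real normed vector space.\<close>

type_synonym 'n cpoly = "('n \<Rightarrow>\<^sub>0 nat) \<Rightarrow>\<^sub>0 complex"

definition mdeg :: "('n::finite \<Rightarrow>\<^sub>0 nat) \<Rightarrow> nat" where
  "mdeg \<alpha> = (\<Sum>i\<in>UNIV. Poly_Mapping.lookup \<alpha> i)"

definition multinom :: "nat \<Rightarrow> ('n::finite \<Rightarrow>\<^sub>0 nat) \<Rightarrow> real" where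
  "multinom d \<alpha> = fact d / (\<Prod>i\<in>UNIV. fact (Poly_Mapping.lookup \<alpha> i))"

definition forms :: "nat \<Rightarrow> ('n::finite) cpoly set" where
  "forms d = {p. \<forall>\<alpha>\<in>Poly_Mapping.keys p. mdeg \<alpha> = d}"

text \<open>The coefficient \<open>p\<^sub>\<alpha>\<close> in the normalisation \<open>p = (\<Sum>\<alpha>. multinom d \<alpha> p\<^sub>\<alpha> x\<^sup>\<alpha>)\<close>.\<close>

definition scaled_coeff :: "nat \<Rightarrow> ('n::finite) cpoly \<Rightarrow> ('n \<Rightarrow>\<^sub>0 nat) \<Rightarrow> complex" where
  "scaled_coeff d p \<alpha> = Poly_Mapping.lookup p \<alpha> / of_real (multinom d \<alpha>)"

definition apolar :: "nat \<Rightarrow> ('n::finite) cpoly \<Rightarrow> 'n cpoly \<Rightarrow> complex" where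
  "apolar d p q = (\<Sum>\<alpha> | mdeg \<alpha> = d.
     of_real (multinom d \<alpha>) * cnj (scaled_coeff d p \<alpha>) * scaled_coeff d q \<alpha>)"

definition apolar_Re :: "nat \<Rightarrow> ('n::finite) cpoly \<Rightarrow> 'n cpoly \<Rightarrow> real" where
  "apolar_Re d p q = Re (apolar d p q)"

definition poly_eval :: "('n::finite) cpoly \<Rightarrow> complex ^ 'n \<Rightarrow> complex" where
  "poly_eval p a = (\<Sum>\<alpha>\<in>Poly_Mapping.keys p. Poly_Mapping.lookup p \<alpha> * (\<Prod>i\<in>UNIV. (a $ i) ^ Poly_Mapping.lookup \<alpha> i))"

text \<open>Gradient of the polynomial function: the vector of complex partial derivatives.\<close>

definition poly_grad :: "('n::finite) cpoly \<Rightarrow> complex ^ 'n \<Rightarrow> complex ^ 'n" where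
  "poly_grad p a = (\<chi> i. deriv (\<lambda>z. poly_eval p (\<chi> k. if k = i then z else a $ k)) (a $ i))"

text \<open>The Hermitian product \<open>u\<^sup>* w\<close>, conjugate linear in the first argument.\<close>

definition herm :: "complex ^ 'n::finite \<Rightarrow> complex ^ 'n \<Rightarrow> complex" where
  "herm u w = (\<Sum>i\<in>UNIV. cnj (u $ i) * w $ i)"

definition cnj_vec :: "complex ^ 'n::finite \<Rightarrow> complex ^ 'n" where
  "cnj_vec v = (\<chi> i. cnj (v $ i))"

definition linform :: "complex ^ 'n::finite \<Rightarrow> 'n cpoly" where
  "linform v = (\<Sum>i\<in>UNIV. Poly_Mapping.single (Poly_Mapping.single i 1) (v $ i))"

definition generic_rank :: "nat \<Rightarrow> nat \<Rightarrow> nat" where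
  "generic_rank d n = nat \<lceil>real ((n + d - 1) choose d) / real n\<rceil>
     + (if (d, n) \<in> {(3, 5), (4, 3), (4, 4), (4, 5)} then 1 else 0)"

definition veronese :: "nat \<Rightarrow> ('n::finite) cpoly set" where
  "veronese d = {linform v ^ d | v. v \<noteq> 0}"

text \<open>The tangent space is attached to the point \<open>q\<close>, not to a representing vector \<open>w\<close>;
  the latter is determined by \<open>q\<close> only up to a \<open>d\<close>-th root of unity.\<close>

definition veronese_tangent :: "nat \<Rightarrow> ('n::finite) cpoly \<Rightarrow> 'n cpoly set" where
  "veronese_tangent d q = {linform u * linform w ^ (d - 1) | u w. w \<noteq> 0 \<and> q = linform w ^ d}"

text \<open>Elements of an \<open>r\<close>-fold product are encoded as finitely supported maps whose
  components have indices \<open>1, \<dots>, r\<close> and which vanish elsewhere.\<close>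

definition veronese_prod :: "nat \<Rightarrow> nat \<Rightarrow> (nat \<Rightarrow>\<^sub>0 ('n::finite) cpoly) set" where
  "veronese_prod d r =
     {y. Poly_Mapping.keys y \<subseteq> {1..r} \<and> (\<forall>i\<in>{1..r}. Poly_Mapping.lookup y i \<in> veronese d)}"

definition prod_tangent :: "nat \<Rightarrow> nat \<Rightarrow> (nat \<Rightarrow>\<^sub>0 ('n::finite) cpoly) \<Rightarrow> (nat \<Rightarrow>\<^sub>0 'n cpoly) set" where
  "prod_tangent d r y =
     {\<eta>. Poly_Mapping.keys \<eta> \<subseteq> {1..r} \<and>
        (\<forall>i\<in>{1..r}. Poly_Mapping.lookup \<eta> i \<in> veronese_tangent d (Poly_Mapping.lookup y i))}"

definition prod_inner :: "nat \<Rightarrow> nat \<Rightarrow> (nat \<Rightarrow>\<^sub>0 ('n::finite) cpoly) \<Rightarrow> (nat \<Rightarrow>\<^sub>0 'n cpoly) \<Rightarrow> real" where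
  "prod_inner d r \<eta> \<xi> = (\<Sum>i=1..r. apolar_Re d (Poly_Mapping.lookup \<eta> i) (Poly_Mapping.lookup \<xi> i))"

definition resid :: "nat \<Rightarrow> ('n::finite) cpoly \<Rightarrow> (nat \<Rightarrow>\<^sub>0 'n cpoly) \<Rightarrow> 'n cpoly" where
  "resid r p y = (\<Sum>i=1..r. Poly_Mapping.lookup y i) - p"

text \<open>The map \<open>F\<close> is the restriction to the product manifold of \<open>resid r p\<close>, so its differential
  at \<open>y\<close> is the restriction of the derivative of \<open>resid r p\<close> to the tangent space at \<open>y\<close>.\<close>

definition Dresid :: "nat \<Rightarrow> ('n::finite) cpoly \<Rightarrow> (nat \<Rightarrow>\<^sub>0 'n cpoly) \<Rightarrow> (nat \<Rightarrow>\<^sub>0 'n cpoly) \<Rightarrow> 'n cpoly" where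
  "Dresid r p y = frechet_derivative (resid r p) (at y)"

lemma lookup_scaleR: "Poly_Mapping.lookup (c *\<^sub>R x) i = c *\<^sub>R Poly_Mapping.lookup (x :: 'a \<Rightarrow>\<^sub>0 'b::real_vector) i"
proof -
  have "finite {i. c *\<^sub>R Poly_Mapping.lookup x i \<noteq> 0}"
    by (rule finite_subset[OF _ finite_keys[of x]]) (auto simp: in_keys_iff)
  then show ?thesis
    by (simp add: scaleR_poly_mapping_def)
qed

lemma norm_lookup_le: "norm (Poly_Mapping.lookup (x :: 'a \<Rightarrow>\<^sub>0 'b::real_normed_vector) i) \<le> norm x"
proof (cases "i \<in> Poly_Mapping.keys x")
  case True
  then show ?thesis
    by (auto simp: norm_poly_mapping_def dist_poly_mapping_def intro!: member_le_sum)
qed (simp add: in_keys_iff)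

lemma bounded_linear_lookup:
  "bounded_linear (\<lambda>x :: 'a \<Rightarrow>\<^sub>0 'b::real_normed_vector. Poly_Mapping.lookup x i)"
  by (rule bounded_linear_intro[where K = 1])
    (simp_all add: lookup_add lookup_scaleR norm_lookup_le)

lemma Dresid_apply: "Dresid r p y \<eta> = (\<Sum>i=1..r. Poly_Mapping.lookup \<eta> i)"
proof -
  have "(resid r p has_derivative (\<lambda>\<eta>. (\<Sum>i=1..r. Poly_Mapping.lookup \<eta> i) - 0)) (at y)"
    unfolding resid_def
    by (intro has_derivative_diff has_derivative_const has_derivative_sum
        bounded_linear_imp_has_derivative bounded_linear_lookup)
  then show ?thesis
    by (simp add: Dresid_def frechet_derivative_at[symmetric])
qed

text \<open>Adjoint, at \<open>w\<close>, of a map \<open>f\<close> from the space \<open>V\<close> with inner product \<open>ipV\<close>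
  to a space with inner product \<open>ipW\<close>.\<close>

definition adjoint_on :: "'a set \<Rightarrow> ('a \<Rightarrow> 'a \<Rightarrow> real) \<Rightarrow> ('b \<Rightarrow> 'b \<Rightarrow> real) \<Rightarrow> ('a \<Rightarrow> 'b) \<Rightarrow> 'b \<Rightarrow> 'a" where
  "adjoint_on V ipV ipW f w = (THE a. a \<in> V \<and> (\<forall>x\<in>V. ipW (f x) w = ipV x a))"

definition Dresid_adj :: "nat \<Rightarrow> nat \<Rightarrow> ('n::finite) cpoly \<Rightarrow> (nat \<Rightarrow>\<^sub>0 'n cpoly) \<Rightarrow> 'n cpoly \<Rightarrow> (nat \<Rightarrow>\<^sub>0 'n cpoly)" where
  "Dresid_adj d r p y =
     adjoint_on (prod_tangent d r y) (prod_inner d r) (apolar_Re d) (Dresid r p y)"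

definition gauss_newton_eq :: "nat \<Rightarrow> nat \<Rightarrow> ('n::finite) cpoly \<Rightarrow> (nat \<Rightarrow>\<^sub>0 'n cpoly) \<Rightarrow> (nat \<Rightarrow>\<^sub>0 'n cpoly) \<Rightarrow> bool" where
  "gauss_newton_eq d r p y \<eta> \<longleftrightarrow> \<eta> \<in> prod_tangent d r y \<and>
     Dresid_adj d r p y (Dresid r p y \<eta>) = - Dresid_adj d r p y (resid r p y)"

definition orthonormal_basis :: "'a::real_vector set \<Rightarrow> ('a \<Rightarrow> 'a \<Rightarrow> real) \<Rightarrow> nat \<Rightarrow> (nat \<Rightarrow> 'a) \<Rightarrow> bool" where
  "orthonormal_basis V ip N b \<longleftrightarrow>
     (\<forall>k\<in>{1..N}. \<forall>l\<in>{1..N}. ip (b k) (b l) = (if k = l then 1 else 0)) \<and>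
     independent (b ` {1..N}) \<and> span (b ` {1..N}) = V"

definition inner_at :: "nat \<Rightarrow> complex ^ 'n::finite \<Rightarrow> complex ^ 'n \<Rightarrow> complex ^ 'n \<Rightarrow> real" where
  "inner_at d v u u' =
     Re (herm u u' + of_nat (d - 1) * (herm u v * herm v u') / of_real ((norm v)\<^sup>2))"

text \<open>The tangent vector \<open>q\<^sub>i\<^sub>,\<^sub>j\<close> obtained from \<open>v = v\<^sub>i\<close> and \<open>u = u\<^sub>i\<^sub>,\<^sub>j\<close>.\<close>

definition qvec :: "nat \<Rightarrow> complex ^ 'n::finite \<Rightarrow> complex ^ 'n \<Rightarrow> 'n cpoly" where
  "qvec d v u = (sqrt (real d) * norm v powi (1 - int d)) *\<^sub>R (linform u * linform v ^ (d - 1))"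

end

theory Submission
  imports Defs
begin

text \<open>Expressed in an orthonormal basis \<open>b\<close>, the adjoint of a linear map \<open>f\<close> sends \<open>w\<close> to the vector
  with coordinates \<open>\<langle>f b\<^sub>k, w\<rangle>\<close> (\<open>adjoint_on_orthonormal_basis\<close>). The differential of the residual adds
  up the components of a tangent vector, so it maps the basis vector of \<open>Q\<close> at position \<open>(i, j)\<close> to
  \<open>qvec d (v i) (u i j)\<close>. The Gauss-Newton equation in the basis \<open>Q\<close> is therefore the system
  of normal equations whose matrix is the Gram matrix of these forms and whose right hand side
  consists of their inner products with the residual, up to sign.

  All these inner products come from one reproducing property of the apolar product
  (\<open>apolar_linform_mult_power\<close>): pairing a form \<open>q\<close> of degree \<open>d\<close> with
  \<open>linform u * linform v ^ (d - 1)\<close> gives \<open>1 / d\<close> times the derivative of \<open>q\<close> at the conjugate of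
  \<open>v\<close> in the direction conjugate to \<open>u\<close>. It holds because the multinomial weights in the apolar
  product cancel the multinomial coefficients of the power of a linear form. Applied to \<open>p\<close> it
  produces the gradient term of \<open>G\<close>; applied to another product
  \<open>linform u' * linform v' ^ (d - 1)\<close>, whose derivative has two summands by the product rule, it
  produces the two summands in the entries of \<open>H\<close>; the choice \<open>u' = v'\<close> merges the two summands and
  gives the remaining part of \<open>G\<close>.

  That \<open>Q\<close> is an orthonormal basis has two reasons. For \<open>v = v'\<close> the same computation yields
  \<open>inner_at d v\<close>, so \<open>qvec d v\<close> is an isometry (\<open>apolar_Re_qvec_same\<close>); and its range is the
  tangent space, because two linear forms with the same \<open>d\<close>-th power are proportional
  (\<open>veronese_tangent_eq_range_qvec\<close>).\<close>

section \<open>Evaluation of polynomials\<close>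

definition monom_val :: "complex ^ 'n::finite \<Rightarrow> ('n \<Rightarrow>\<^sub>0 nat) \<Rightarrow> complex" where
  "monom_val a \<alpha> = (\<Prod>i\<in>UNIV. (a $ i) ^ Poly_Mapping.lookup \<alpha> i)"

lemma monom_val_add: "monom_val a (\<alpha> + \<beta>) = monom_val a \<alpha> * monom_val a \<beta>"
  by (simp add: monom_val_def lookup_add power_add prod.distrib)

lemma monom_val_zero [simp]: "monom_val a 0 = 1"
  by (simp add: monom_val_def)

lemma monom_val_single: "monom_val a (Poly_Mapping.single k m) = (a $ k) ^ m"
proof -
  have "monom_val a (Poly_Mapping.single k m) = (\<Prod>i\<in>UNIV. if i = k then (a $ k) ^ m else 1)"
    unfolding monom_val_def by (rule prod.cong) (auto simp: lookup_single when_def)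
  then show ?thesis by simp
qed

lemma monom_val_cnj: "monom_val (cnj_vec a) \<alpha> = cnj (monom_val a \<alpha>)"
  by (simp add: monom_val_def cnj_vec_def)

lemma poly_eval_superset:
  assumes "finite A" "Poly_Mapping.keys p \<subseteq> A"
  shows "poly_eval p a = (\<Sum>\<alpha>\<in>A. Poly_Mapping.lookup p \<alpha> * monom_val a \<alpha>)"
  unfolding poly_eval_def monom_val_def[symmetric]
  by (rule sum.mono_neutral_left) (use assms in \<open>auto simp: in_keys_iff\<close>)

lemma poly_eval_zero [simp]: "poly_eval 0 a = 0"
  by (simp add: poly_eval_def)

lemma poly_eval_add: "poly_eval (p + q) a = poly_eval p a + poly_eval q a"
proof -
  let ?A = "Poly_Mapping.keys p \<union> Poly_Mapping.keys q"
  have "poly_eval (p + q) a = (\<Sum>\<alpha>\<in>?A. Poly_Mapping.lookup (p + q) \<alpha> * monom_val a \<alpha>)"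
    by (rule poly_eval_superset) (use keys_add[of p q] in auto)
  also have "\<dots> = poly_eval p a + poly_eval q a"
    by (simp add: poly_eval_superset[of ?A] lookup_add distrib_right sum.distrib)
  finally show ?thesis .
qed

lemma poly_eval_sum: "poly_eval (sum f I) a = (\<Sum>i\<in>I. poly_eval (f i) a)"
  by (induction I rule: infinite_finite_induct) (simp_all add: poly_eval_add)

lemma poly_eval_single [simp]:
  "poly_eval (Poly_Mapping.single \<alpha> c) a = c * monom_val a \<alpha>"
  by (simp add: poly_eval_superset[of "{\<alpha>}"])

text \<open>The expansion into monomials reduces multiplicativity of evaluation to products of monomials;
  for families indexed by numbers it splits a tangent vector of the product into its components.\<close>

lemma poly_mapping_sum_single:
  "p = (\<Sum>\<alpha>\<in>Poly_Mapping.keys p. Poly_Mapping.single \<alpha> (Poly_Mapping.lookup p \<alpha>))"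
proof (rule poly_mapping_eqI)
  fix \<beta>
  have "(\<Sum>\<alpha>\<in>Poly_Mapping.keys p. Poly_Mapping.lookup p \<alpha> when \<alpha> = \<beta>) =
      (\<Sum>\<alpha>\<in>Poly_Mapping.keys p. if \<alpha> = \<beta> then Poly_Mapping.lookup p \<beta> else 0)"
    by (rule sum.cong) (auto simp: when_def)
  then show "Poly_Mapping.lookup p \<beta> = Poly_Mapping.lookup
      (\<Sum>\<alpha>\<in>Poly_Mapping.keys p. Poly_Mapping.single \<alpha> (Poly_Mapping.lookup p \<alpha>)) \<beta>"
    by (simp add: lookup_sum lookup_single in_keys_iff)
qed

lemma poly_eval_mult: "poly_eval (p * q) a = poly_eval p a * poly_eval q a"
proof -
  let ?P = "Poly_Mapping.lookup p" and ?Q = "Poly_Mapping.lookup q"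
  have "p * q = (\<Sum>\<alpha>\<in>Poly_Mapping.keys p. Poly_Mapping.single \<alpha> (?P \<alpha>)) *
      (\<Sum>\<beta>\<in>Poly_Mapping.keys q. Poly_Mapping.single \<beta> (?Q \<beta>))"
    by (simp flip: poly_mapping_sum_single)
  also have "\<dots> = (\<Sum>\<alpha>\<in>Poly_Mapping.keys p. \<Sum>\<beta>\<in>Poly_Mapping.keys q.
      Poly_Mapping.single (\<alpha> + \<beta>) (?P \<alpha> * ?Q \<beta>))"
    by (simp only: sum_product mult_single)
  finally have "poly_eval (p * q) a = (\<Sum>\<alpha>\<in>Poly_Mapping.keys p. \<Sum>\<beta>\<in>Poly_Mapping.keys q.
      (?P \<alpha> * monom_val a \<alpha>) * (?Q \<beta> * monom_val a \<beta>))"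
    by (simp add: poly_eval_sum monom_val_add mult_ac)
  also have "\<dots> = poly_eval p a * poly_eval q a"
    unfolding poly_eval_def monom_val_def[symmetric] by (simp only: sum_product)
  finally show ?thesis .
qed

lemma poly_eval_power: "poly_eval (p ^ m) a = poly_eval p a ^ m"
proof (induction m)
  case 0
  show ?case by (simp flip: single_one)
qed (simp add: poly_eval_mult)

lemma poly_eval_linform: "poly_eval (linform v) a = (\<Sum>i\<in>UNIV. v $ i * a $ i)"
  by (simp add: linform_def poly_eval_sum monom_val_single)

section \<open>Coefficients of powers of linear forms\<close>

lemma mdeg_add: "mdeg (\<alpha> + \<beta>) = mdeg \<alpha> + mdeg \<beta>"
  by (simp add: mdeg_def lookup_add sum.distrib)

lemma mdeg_single: "mdeg (Poly_Mapping.single k m) = m"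
proof -
  have "mdeg (Poly_Mapping.single k m) = (\<Sum>i\<in>UNIV. if i = k then m else 0)"
    unfolding mdeg_def by (rule sum.cong) (auto simp: lookup_single when_def)
  then show ?thesis by simp
qed

lemma mdeg_zero_iff: "mdeg \<alpha> = 0 \<longleftrightarrow> \<alpha> = 0"
  by (auto simp: mdeg_def intro!: poly_mapping_eqI)

text \<open>The apolar product is a sum over this set, and would be \<open>0\<close> by convention if it were infinite.\<close>

lemma finite_mdeg: "finite {\<alpha> :: 'n::finite \<Rightarrow>\<^sub>0 nat. mdeg \<alpha> = d}"
proof -
  have "Poly_Mapping.lookup \<alpha> i \<le> mdeg \<alpha>" for \<alpha> :: "'n \<Rightarrow>\<^sub>0 nat" and i
    unfolding mdeg_def by (rule member_le_sum) auto
  then have "Poly_Mapping.lookup ` {\<alpha> :: 'n \<Rightarrow>\<^sub>0 nat. mdeg \<alpha> = d} \<subseteq> (\<Pi>\<^sub>E i\<in>UNIV. {..d})"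
    by auto
  then have "finite (Poly_Mapping.lookup ` {\<alpha> :: 'n \<Rightarrow>\<^sub>0 nat. mdeg \<alpha> = d})"
    by (rule finite_subset) (simp add: finite_PiE)
  moreover have "inj_on Poly_Mapping.lookup {\<alpha> :: 'n \<Rightarrow>\<^sub>0 nat. mdeg \<alpha> = d}"
    by (simp add: inj_on_def poly_mapping.lookup_inject)
  ultimately show ?thesis
    by (rule finite_imageD)
qed

text \<open>The exponent of a monomial after differentiation in the variable \<open>k\<close>. The subtraction is
  truncated: if the variable is absent, the exponent does not change.\<close>

definition lower :: "'n \<Rightarrow> ('n \<Rightarrow>\<^sub>0 nat) \<Rightarrow> ('n \<Rightarrow>\<^sub>0 nat)" where
  "lower k \<alpha> = \<alpha> - Poly_Mapping.single k 1"

lemma lookup_lower: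
  "Poly_Mapping.lookup (lower k \<alpha>) i =
    (if i = k then Poly_Mapping.lookup \<alpha> k - 1 else Poly_Mapping.lookup \<alpha> i)"
  by (auto simp: lower_def lookup_minus lookup_single)

lemma add_lower:
  assumes "Poly_Mapping.lookup \<alpha> k \<noteq> 0"
  shows "\<alpha> = Poly_Mapping.single k 1 + lower k \<alpha>"
  using assms
  by (intro poly_mapping_eqI) (auto simp: lookup_add lookup_lower lookup_single when_def)

lemma lookup_var_mult:
  fixes f :: "('n::finite) cpoly"
  shows "Poly_Mapping.lookup (Poly_Mapping.single (Poly_Mapping.single k 1) c * f) \<alpha> =
    (if Poly_Mapping.lookup \<alpha> k = 0 then 0 else c * Poly_Mapping.lookup f (lower k \<alpha>))"
proof -
  let ?e = "Poly_Mapping.single k (1::nat)"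
  have eq: "\<alpha> = ?e + \<beta> \<longleftrightarrow> Poly_Mapping.lookup \<alpha> k \<noteq> 0 \<and> lower k \<alpha> = \<beta>" for \<beta>
  proof
    assume "\<alpha> = ?e + \<beta>"
    then show "Poly_Mapping.lookup \<alpha> k \<noteq> 0 \<and> lower k \<alpha> = \<beta>"
      by (simp add: lookup_add lower_def)
  next
    assume "Poly_Mapping.lookup \<alpha> k \<noteq> 0 \<and> lower k \<alpha> = \<beta>"
    then show "\<alpha> = ?e + \<beta>"
      using add_lower[of \<alpha> k] by blast
  qed
  have "Poly_Mapping.lookup (Poly_Mapping.single ?e c * f) \<alpha> =
      c * (\<Sum>\<beta>. Poly_Mapping.lookup f \<beta> when \<alpha> = ?e + \<beta>)"
    by (simp add: lookup_mult lookup_single when_mult)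
  also have "\<dots> = (if Poly_Mapping.lookup \<alpha> k = 0 then 0
     else c * Poly_Mapping.lookup f (lower k \<alpha>))"
    unfolding eq by simp
  finally show ?thesis .
qed

lemma multinom_pos: "multinom d \<alpha> > 0"
  by (simp add: multinom_def prod_pos)

lemma multinom_lower:
  assumes "Poly_Mapping.lookup \<alpha> k \<noteq> 0"
  shows "multinom m (lower k \<alpha>) =
    multinom (Suc m) \<alpha> * real (Poly_Mapping.lookup \<alpha> k) / real (Suc m)"
proof -
  let ?L = "Poly_Mapping.lookup \<alpha>"
  define R :: real where "R = (\<Prod>i\<in>UNIV - {k}. fact (?L i))"
  have split: "(\<Prod>i\<in>UNIV. fact (Poly_Mapping.lookup \<beta> i)) =
      fact (Poly_Mapping.lookup \<beta> k) * (\<Prod>i\<in>UNIV - {k}. fact (Poly_Mapping.lookup \<beta> i) :: real)"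
    for \<beta> by (rule prod.remove) auto
  have "multinom m (lower k \<alpha>) = fact m / (fact (?L k - 1) * R)"
    unfolding multinom_def split R_def by (simp add: lookup_lower cong: prod.cong_simp)
  moreover have "multinom (Suc m) \<alpha> = real (Suc m) * fact m / (real (?L k) * fact (?L k - 1) * R)"
    unfolding multinom_def split R_def using assms by (simp add: fact_reduce[of "?L k"])
  ultimately show ?thesis
    using assms by simp
qed

lemma mdeg_lower:
  assumes "Poly_Mapping.lookup \<alpha> k \<noteq> 0"
  shows "mdeg \<alpha> = Suc (mdeg (lower k \<alpha>))"
  by (subst add_lower[OF assms]) (simp only: mdeg_add mdeg_single plus_1_eq_Suc)

lemma monom_val_lower:
  assumes "Poly_Mapping.lookup \<alpha> k \<noteq> 0"
  shows "monom_val a \<alpha> = a $ k * monom_val a (lower k \<alpha>)"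
  by (subst add_lower[OF assms]) (simp only: monom_val_add monom_val_single power_one_right)

lemma lookup_linform_mult:
  "Poly_Mapping.lookup (linform u * f) \<alpha> =
    (\<Sum>k\<in>UNIV. if Poly_Mapping.lookup \<alpha> k = 0 then 0
       else u $ k * Poly_Mapping.lookup f (lower k \<alpha>))"
  unfolding linform_def sum_distrib_right lookup_sum lookup_var_mult ..

text \<open>The multinomial theorem. In the induction step each variable contributes the share
  \<open>\<alpha>\<^sub>k / (m + 1)\<close> of the coefficient, and these shares add up to \<open>1\<close>.\<close>

lemma lookup_linform_power:
  "Poly_Mapping.lookup (linform v ^ m) \<alpha> =
    (if mdeg \<alpha> = m then of_real (multinom m \<alpha>) * monom_val v \<alpha> else 0)"
proof (induction m arbitrary: \<alpha>)
  case 0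
  show ?case
    by (auto simp: lookup_one when_def mdeg_zero_iff multinom_def)
next
  case (Suc m)
  have "Poly_Mapping.lookup (linform v ^ Suc m) \<alpha> =
      (\<Sum>k\<in>UNIV. if mdeg \<alpha> = Suc m
        then of_real (multinom (Suc m) \<alpha>) * monom_val v \<alpha> / of_nat (Suc m) *
             of_nat (Poly_Mapping.lookup \<alpha> k)
        else 0)"
    unfolding power_Suc lookup_linform_mult Suc.IH
    by (rule sum.cong) (auto simp: multinom_lower monom_val_lower mdeg_lower simp del: of_nat_Suc)
  also have "\<dots> = (if mdeg \<alpha> = Suc m then
      of_real (multinom (Suc m) \<alpha>) * monom_val v \<alpha> / of_nat (Suc m) * of_nat (mdeg \<alpha>) else 0)"
    unfolding mdeg_def[of \<alpha>] of_nat_sum sum_distrib_left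
    by (cases "sum (Poly_Mapping.lookup \<alpha>) UNIV = Suc m") (simp_all del: of_nat_Suc)
  finally show ?case
    by (auto simp del: of_nat_Suc)
qed

text \<open>In this form no case distinction on the presence of a variable is left: where the truncation in
  \<open>lower k \<alpha>\<close> takes effect, the factor \<open>\<alpha>\<^sub>k\<close> is \<open>0\<close>. The sum is the derivative of the monomial
  at \<open>v\<close> in the direction \<open>u\<close>, which is how the gradient enters the apolar product.\<close>

lemma lookup_linform_mult_power:
  assumes "mdeg \<alpha> = Suc m"
  shows "Poly_Mapping.lookup (linform u * linform v ^ m) \<alpha> =
    of_real (multinom (Suc m) \<alpha>) / of_nat (Suc m) *
      (\<Sum>k\<in>UNIV. u $ k * of_nat (Poly_Mapping.lookup \<alpha> k) *
         monom_val v (lower k \<alpha>))"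
  unfolding lookup_linform_mult lookup_linform_power sum_distrib_left
  by (rule sum.cong) (use assms in \<open>auto simp: multinom_lower mdeg_lower simp del: of_nat_Suc\<close>)

lemma linform_mult_power_in_forms: "linform u * linform v ^ m \<in> forms (Suc m)"
proof -
  have "mdeg \<alpha> = Suc m" if nz: "Poly_Mapping.lookup (linform u * linform v ^ m) \<alpha> \<noteq> 0" for \<alpha>
  proof (rule ccontr)
    assume "mdeg \<alpha> \<noteq> Suc m"
    then have "Poly_Mapping.lookup (linform u * linform v ^ m) \<alpha> = 0"
      unfolding lookup_linform_mult lookup_linform_power
      by (intro sum.neutral) (auto simp: mdeg_lower)
    with nz show False ..
  qed
  then show ?thesis
    by (simp add: forms_def in_keys_iff)
qed

section \<open>The reproducing property of the apolar product\<close>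

lemma poly_grad_component:
  "poly_grad q a $ k =
    (\<Sum>\<alpha>\<in>Poly_Mapping.keys q. Poly_Mapping.lookup q \<alpha> * of_nat (Poly_Mapping.lookup \<alpha> k) *
       monom_val a (lower k \<alpha>))"
proof -
  have mono: "((\<lambda>z. monom_val (\<chi> l. if l = k then z else a $ l) \<alpha>) has_field_derivative
      of_nat (Poly_Mapping.lookup \<alpha> k) * monom_val a (lower k \<alpha>)) (at (a $ k))"
    for \<alpha>
  proof -
    define C where "C = (\<Prod>i\<in>UNIV - {k}. (a $ i) ^ Poly_Mapping.lookup \<alpha> i)"
    have split: "monom_val b \<beta> =
        (b $ k) ^ Poly_Mapping.lookup \<beta> k * (\<Prod>i\<in>UNIV - {k}. (b $ i) ^ Poly_Mapping.lookup \<beta> i)"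
      for b \<beta> unfolding monom_val_def by (rule prod.remove) auto
    have "monom_val (\<chi> l. if l = k then z else a $ l) \<alpha> = z ^ Poly_Mapping.lookup \<alpha> k * C" for z
      unfolding split C_def by simp
    moreover have "monom_val a (lower k \<alpha>) =
        (a $ k) ^ (Poly_Mapping.lookup \<alpha> k - 1) * C"
      unfolding split C_def by (simp add: lookup_lower cong: prod.cong_simp)
    ultimately show ?thesis
      by (auto intro!: derivative_eq_intros)
  qed
  have "((\<lambda>z. poly_eval q (\<chi> l. if l = k then z else a $ l)) has_field_derivative
      (\<Sum>\<alpha>\<in>Poly_Mapping.keys q. Poly_Mapping.lookup q \<alpha> * (of_nat (Poly_Mapping.lookup \<alpha> k) *
       monom_val a (lower k \<alpha>)))) (at (a $ k))"
    unfolding poly_eval_def monom_val_def[symmetric]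
    by (intro DERIV_sum DERIV_cmult mono)
  then show ?thesis
    by (simp add: poly_grad_def DERIV_imp_deriv mult.assoc)
qed

text \<open>The multinomial coefficient occurs twice in a denominator and twice in a numerator of each
  summand of the apolar product. After cancellation, each coefficient of \<open>q\<close> is weighted by
  the conjugate of the derivative of its monomial at \<open>v\<close> along \<open>u\<close>, and the weighted coefficients
  add up to a directional derivative of \<open>q\<close>.\<close>

lemma apolar_linform_mult_power:
  assumes "q \<in> forms (Suc m)"
  shows "apolar (Suc m) (linform u * linform v ^ m) q =
    herm u (poly_grad q (cnj_vec v)) / of_nat (Suc m)"
proof -
  let ?D = "\<lambda>\<alpha> k. of_nat (Poly_Mapping.lookup \<alpha> k) *
         monom_val (cnj_vec v) (lower k \<alpha>) :: complex"
  have "apolar (Suc m) (linform u * linform v ^ m) q =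
      (\<Sum>\<alpha> | mdeg \<alpha> = Suc m. Poly_Mapping.lookup q \<alpha> * (\<Sum>k\<in>UNIV. cnj (u $ k) * ?D \<alpha> k)
        / of_nat (Suc m))"
    unfolding apolar_def scaled_coeff_def
  proof (rule sum.cong)
    fix \<alpha> :: "'a \<Rightarrow>\<^sub>0 nat"
    assume "\<alpha> \<in> {\<alpha>. mdeg \<alpha> = Suc m}"
    then show "of_real (multinom (Suc m) \<alpha>)
        * cnj (Poly_Mapping.lookup (linform u * linform v ^ m) \<alpha> / of_real (multinom (Suc m) \<alpha>))
        * (Poly_Mapping.lookup q \<alpha> / of_real (multinom (Suc m) \<alpha>)) =
      Poly_Mapping.lookup q \<alpha> * (\<Sum>k\<in>UNIV. cnj (u $ k) * ?D \<alpha> k) / of_nat (Suc m)"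
      using multinom_pos[of "Suc m" \<alpha>]
      by (simp add: lookup_linform_mult_power monom_val_cnj mult.assoc del: of_nat_Suc)
  qed simp
  also have "\<dots> = (\<Sum>\<alpha>\<in>Poly_Mapping.keys q.
      Poly_Mapping.lookup q \<alpha> * (\<Sum>k\<in>UNIV. cnj (u $ k) * ?D \<alpha> k) / of_nat (Suc m))"
    by (rule sum.mono_neutral_right)
      (use assms in \<open>auto simp: finite_mdeg forms_def in_keys_iff\<close>)
  also have "\<dots> = herm u (poly_grad q (cnj_vec v)) / of_nat (Suc m)"
    unfolding herm_def poly_grad_component sum_distrib_left sum_divide_distrib
    by (subst sum.swap) (simp add: mult_ac)
  finally show ?thesis .
qed

text \<open>The product rule is applied to the evaluations of the factors, which are affine functions of the
  variable \<open>k\<close>.\<close>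

lemma poly_grad_linform_mult_power:
  "poly_grad (linform u * linform v ^ m) a $ k =
    u $ k * poly_eval (linform v) a ^ m
    + of_nat m * poly_eval (linform u) a * v $ k * poly_eval (linform v) a ^ (m - 1)"
proof -
  have lin: "((\<lambda>z. poly_eval (linform w) (\<chi> l. if l = k then z else a $ l))
      has_field_derivative w $ k) (at (a $ k))" for w :: "complex ^ 'a"
  proof -
    have "poly_eval (linform w) (\<chi> l. if l = k then z else a $ l) =
        w $ k * z + (\<Sum>i\<in>UNIV - {k}. w $ i * a $ i)" for z
      unfolding poly_eval_linform by (subst sum.remove[of _ k]) auto
    then show ?thesis by (auto intro!: derivative_eq_intros)
  qed
  have "(\<chi> l. if l = k then a $ k else a $ l) = a"
    by (simp add: vec_eq_iff)
  then have "((\<lambda>z. poly_eval (linform u * linform v ^ m) (\<chi> l. if l = k then z else a $ l))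
      has_field_derivative
        u $ k * poly_eval (linform v) a ^ m
        + of_nat m * poly_eval (linform u) a * v $ k * poly_eval (linform v) a ^ (m - 1))
      (at (a $ k))"
    unfolding poly_eval_mult poly_eval_power
    by (auto intro!: derivative_eq_intros lin)
  then show ?thesis
    by (simp add: poly_grad_def DERIV_imp_deriv)
qed

lemma poly_eval_linform_cnj: "poly_eval (linform w) (cnj_vec v) = herm v w"
  by (simp add: poly_eval_linform cnj_vec_def herm_def mult.commute)

lemma apolar_linform_mult_powers:
  "apolar (Suc m) (linform u * linform v ^ m) (linform u' * linform v' ^ m) =
    (herm u u' * herm v v' ^ m + of_nat m * (herm u v' * herm v u' * herm v v' ^ (m - 1)))
      / of_nat (Suc m)"
proof -
  have "herm u (poly_grad (linform u' * linform v' ^ m) (cnj_vec v)) =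
      herm u u' * herm v v' ^ m + of_nat m * (herm u v' * herm v u' * herm v v' ^ (m - 1))"
    unfolding herm_def[of u] poly_grad_linform_mult_power poly_eval_linform_cnj
    by (simp add: sum.distrib sum_distrib_left sum_distrib_right algebra_simps)
  then show ?thesis
    by (simp only: apolar_linform_mult_power[OF linform_mult_power_in_forms])
qed

section \<open>The apolar product as a real inner product\<close>

text \<open>Real bilinearity is immediate from that of the inner product on the complex plane.\<close>

lemma apolar_Re_eq_sum_inner:
  "apolar_Re d p q = (\<Sum>\<alpha> | mdeg \<alpha> = d.
     (Poly_Mapping.lookup p \<alpha> \<bullet> Poly_Mapping.lookup q \<alpha>) / multinom d \<alpha>)"
  unfolding apolar_Re_def apolar_def scaled_coeff_def Re_sum
proof (rule sum.cong)
  fix \<alpha> :: "'a \<Rightarrow>\<^sub>0 nat"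
  show "Re (of_real (multinom d \<alpha>) * cnj (Poly_Mapping.lookup p \<alpha> / of_real (multinom d \<alpha>))
      * (Poly_Mapping.lookup q \<alpha> / of_real (multinom d \<alpha>))) =
    (Poly_Mapping.lookup p \<alpha> \<bullet> Poly_Mapping.lookup q \<alpha>) / multinom d \<alpha>"
    using multinom_pos[of d \<alpha>] by (simp add: inner_complex_def)
qed simp

lemma bilinear_apolar_Re: "bilinear (apolar_Re d)"
proof -
  have "linear (apolar_Re d p)" for p :: "'a cpoly"
    by (rule linearI)
      (simp_all add: apolar_Re_eq_sum_inner lookup_add lookup_scaleR inner_add_right
        add_divide_distrib sum.distrib sum_distrib_left)
  moreover have "linear (\<lambda>p. apolar_Re d p q)" for q :: "'a cpoly"
    by (rule linearI)
      (simp_all add: apolar_Re_eq_sum_inner lookup_add lookup_scaleR inner_add_left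
        add_divide_distrib sum.distrib sum_distrib_left)
  ultimately show ?thesis
    by (simp add: bilinear_def)
qed

lemma bilinear_prod_inner: "bilinear (prod_inner d r)"
proof -
  note lin = bilinear_apolar_Re[unfolded bilinear_def]
  have "linear (prod_inner d r \<eta>)" for \<eta> :: "nat \<Rightarrow>\<^sub>0 'a cpoly"
    unfolding prod_inner_def
    by (intro linear_compose_sum ballI linear_compose[unfolded comp_def, OF bounded_linear.linear[OF bounded_linear_lookup]])
      (use lin in blast)
  moreover have "linear (\<lambda>\<eta>. prod_inner d r \<eta> \<xi>)" for \<xi> :: "nat \<Rightarrow>\<^sub>0 'a cpoly"
    unfolding prod_inner_def
    by (intro linear_compose_sum ballI
        linear_compose[OF bounded_linear.linear[OF bounded_linear_lookup], unfolded comp_def, where g = "\<lambda>p. apolar_Re d p _"])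
      (use lin in blast)
  ultimately show ?thesis
    by (simp add: bilinear_def)
qed

lemma prod_inner_single:
  assumes "i \<in> {1..r}" "i' \<in> {1..r}"
  shows "prod_inner d r (Poly_Mapping.single i p) (Poly_Mapping.single i' q) =
    (if i = i' then apolar_Re d p q else 0)"
proof -
  have "apolar_Re d (Poly_Mapping.lookup (Poly_Mapping.single i p) l)
      (Poly_Mapping.lookup (Poly_Mapping.single i' q) l) =
      (if l = i then if i = i' then apolar_Re d p q else 0 else 0)" for l
    using bilinear_lzero[OF bilinear_apolar_Re] bilinear_rzero[OF bilinear_apolar_Re]
    by (auto simp: lookup_single when_def)
  then show ?thesis
    using assms by (simp add: prod_inner_def)
qed

section \<open>Orthonormal bases and adjoints\<close>

lemma bilinear_sum_right:
  assumes "bilinear ip"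
  shows "ip x (\<Sum>k\<in>I. c k *\<^sub>R b k) = (\<Sum>k\<in>I. c k * ip x (b k))"
proof -
  have "linear (ip x)"
    using assms by (simp add: bilinear_def)
  then show ?thesis
    by (simp add: linear_sum linear_cmul)
qed

lemma orthonormal_coeff:
  fixes N :: nat
  assumes "bilinear ip"
    and "\<And>k l. k \<in> {1..N} \<Longrightarrow> l \<in> {1..N} \<Longrightarrow> ip (b k) (b l) = (if k = l then 1 else 0)"
    and "k \<in> {1..N}"
  shows "ip (b k) (\<Sum>l=1..N. c l *\<^sub>R b l) = c k"
proof -
  have "(\<Sum>l=1..N. c l * ip (b k) (b l)) = (\<Sum>l=1..N. if l = k then c k else 0)"
    using assms(2,3) by (intro sum.cong) auto
  then show ?thesis
    using assms(1,3) by (simp add: bilinear_sum_right)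
qed

lemma orthonormal_inj_on:
  assumes "\<And>k l. k \<in> I \<Longrightarrow> l \<in> I \<Longrightarrow> ip (b k) (b l) = (if k = l then 1 else (0::real))"
  shows "inj_on b I"
  using assms by (intro inj_onI) (metis zero_neq_one)

lemma orthonormal_basisI:
  fixes N :: nat
  assumes bil: "bilinear ip"
    and on: "\<And>k l. k \<in> {1..N} \<Longrightarrow> l \<in> {1..N} \<Longrightarrow> ip (b k) (b l) = (if k = l then 1 else 0)"
    and "span (b ` {1..N}) = V"
  shows "orthonormal_basis V ip N b"
proof -
  have inj: "inj_on b {1..N}"
    using on by (rule orthonormal_inj_on)
  have "independent (b ` {1..N})"
  proof (rule independent_if_scalars_zero)
    fix c x
    assume "(\<Sum>x\<in>b ` {1..N}. c x *\<^sub>R x) = 0" "x \<in> b ` {1..N}"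
    then obtain k where k: "k \<in> {1..N}" "x = b k" and "(\<Sum>l=1..N. c (b l) *\<^sub>R b l) = 0"
      unfolding sum.reindex[OF inj] comp_def by blast
    then show "c x = 0"
      using orthonormal_coeff[OF bil on k(1), where c = "\<lambda>l. c (b l)"] bilinear_rzero[OF bil] by simp
  qed simp
  then show ?thesis
    using assms by (simp add: orthonormal_basis_def)
qed

lemma orthonormal_expansion:
  assumes bil: "bilinear ip" and ob: "orthonormal_basis V ip N b" and x: "x \<in> V"
  shows "x = (\<Sum>k=1..N. ip (b k) x *\<^sub>R b k)"
proof -
  have on: "\<And>k l. k \<in> {1..N} \<Longrightarrow> l \<in> {1..N} \<Longrightarrow> ip (b k) (b l) = (if k = l then 1 else 0)"
    using ob by (simp add: orthonormal_basis_def)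
  then have inj: "inj_on b {1..N}"
    by (rule orthonormal_inj_on)
  from x ob obtain c where "x = (\<Sum>y\<in>b ` {1..N}. c y *\<^sub>R y)"
    by (auto simp: orthonormal_basis_def span_finite)
  then have *: "x = (\<Sum>k=1..N. c (b k) *\<^sub>R b k)"
    by (simp only: sum.reindex[OF inj] comp_def)
  have "ip (b k) x = c (b k)" if "k \<in> {1..N}" for k
    unfolding * using orthonormal_coeff[OF bil on that] .
  with * show ?thesis by simp
qed

text \<open>The proposed vector satisfies the defining identity on the basis, hence on its span; conversely,
  that identity prescribes the coordinates of any candidate.\<close>

lemma adjoint_on_orthonormal_basis:
  assumes bil: "bilinear ipV" and ob: "orthonormal_basis V ipV N b"
    and bilW: "bilinear ipW" and f: "linear f"
  shows "adjoint_on V ipV ipW f w = (\<Sum>k=1..N. ipW (f (b k)) w *\<^sub>R b k)"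
  unfolding adjoint_on_def
proof (rule the_equality)
  let ?a = "\<Sum>k=1..N. ipW (f (b k)) w *\<^sub>R b k"
  have on: "\<And>k l. k \<in> {1..N} \<Longrightarrow> l \<in> {1..N} \<Longrightarrow> ipV (b k) (b l) = (if k = l then 1 else 0)"
    using ob by (simp add: orthonormal_basis_def)
  have bV: "b k \<in> V" if "k \<in> {1..N}" for k
    using ob that by (auto simp: orthonormal_basis_def intro: span_base)
  have linV: "linear (\<lambda>x. ipV x ?a)"
    using bil by (simp add: bilinear_def)
  have linW: "linear (\<lambda>x. ipW (f x) w)"
    using linear_compose[OF f, of "\<lambda>z. ipW z w"] bilW by (simp add: bilinear_def comp_def)
  have "?a \<in> V"
    using bV ob span_sum[of "{1..N}" "\<lambda>k. ipW (f (b k)) w *\<^sub>R b k" "b ` {1..N}"]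
    by (auto simp: orthonormal_basis_def intro: span_scale)
  moreover have "ipW (f x) w = ipV x ?a" if "x \<in> V" for x
  proof (rule linear_eq_on[OF linW linV])
    show "x \<in> span (b ` {1..N})"
      using that ob by (simp add: orthonormal_basis_def)
    show "ipW (f y) w = ipV y ?a" if "y \<in> b ` {1..N}" for y
      using that orthonormal_coeff[OF bil on, where c = "\<lambda>k. ipW (f (b k)) w"] by auto
  qed
  ultimately show "?a \<in> V \<and> (\<forall>x\<in>V. ipW (f x) w = ipV x ?a)"
    by blast
  fix a
  assume a: "a \<in> V \<and> (\<forall>x\<in>V. ipW (f x) w = ipV x a)"
  then have "a = (\<Sum>k=1..N. ipV (b k) a *\<^sub>R b k)"
    using orthonormal_expansion[OF bil ob] by blast
  also have "\<dots> = ?a"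
    using a bV by (intro sum.cong) auto
  finally show "a = ?a" .
qed

section \<open>The tangent spaces\<close>

lemma herm_self: "herm v v = of_real ((norm v)\<^sup>2)"
proof -
  have "herm v v = of_real (\<Sum>i\<in>UNIV. (norm (v $ i))\<^sup>2)"
    by (simp add: herm_def complex_mult_cnj cmod_power2 mult.commute)
  then show ?thesis
    by (simp add: norm_vec_def L2_set_def sum_nonneg)
qed

lemma scaleR_mult_poly:
  fixes p q :: "('n::finite) cpoly"
  shows "(c *\<^sub>R p) * q = c *\<^sub>R (p * q)"
proof -
  have eq: "c *\<^sub>R f = Poly_Mapping.single 0 (of_real c) * f" for f :: "'n cpoly"
    by (intro poly_mapping_eqI) (simp add: lookup_scaleR lookup_mult lookup_single when_mult scaleR_conv_of_real)
  show ?thesis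
    by (simp only: eq mult.assoc)
qed

lemma linform_scale: "linform (c *s v) = Poly_Mapping.single 0 c * linform v"
  by (simp add: linform_def sum_distrib_left mult_single)

lemma linear_linform: "linear linform"
proof (rule linearI)
  show "linform (u + v) = linform u + linform v" for u v :: "complex ^ 'n"
    by (simp add: linform_def single_add sum.distrib)
  show "linform (c *\<^sub>R v) = c *\<^sub>R linform v" for c and v :: "complex ^ 'n"
    by (intro poly_mapping_eqI)
      (simp add: linform_def lookup_scaleR lookup_sum lookup_single when_def scaleR_sum_right if_distrib cong: if_cong)
qed

lemma linear_qvec: "linear (qvec d v)"
  by (rule linearI)
    (simp_all add: qvec_def linear_add[OF linear_linform] linear_cmul[OF linear_linform]
      distrib_right scaleR_add_right scaleR_mult_poly mult.commute)

text \<open>The vector \<open>e\<close> below is the component of \<open>w\<close> orthogonal to \<open>v\<close>. Evaluation at its conjugate kills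
  the power of the form of \<open>v\<close>, hence also that of the form of \<open>w\<close>; so \<open>e\<close> is orthogonal to \<open>w\<close> as well as
  to \<open>v\<close>, and therefore to itself.\<close>

lemma linform_power_eq_imp_scale:
  assumes "v \<noteq> 0" "d > 0" and eq: "linform v ^ d = linform w ^ d"
  obtains c where "w = c *s v"
proof
  define c where "c = herm v w / herm v v"
  define e where "e = w - c *s v"
  have vv: "herm v v \<noteq> 0"
    using \<open>v \<noteq> 0\<close> by (simp add: herm_self)
  have sub: "herm x e = herm x w - c * herm x v" for x
    by (simp add: e_def herm_def sum_subtractf sum_distrib_left algebra_simps)
  have "herm v e = 0"
    using vv by (simp add: sub c_def)
  moreover have "herm e v = cnj (herm v e)"
    by (simp add: herm_def mult.commute)
  ultimately have ev: "herm e v = 0" by simp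
  have "herm e v ^ d = herm e w ^ d"
    using arg_cong[OF eq, of "\<lambda>p. poly_eval p (cnj_vec e)"]
    by (simp add: poly_eval_power poly_eval_linform_cnj)
  with ev \<open>d > 0\<close> have "herm e w = 0" by (simp add: power_0_left)
  with ev have "herm e e = 0" by (simp add: sub)
  then have "e = 0" by (simp add: herm_self)
  then show "w = c *s v" by (simp add: e_def)
qed

text \<open>The tangent space allows every vector representing the point. By the preceding lemma they are
  all complex multiples of \<open>v\<close>, and the scalar can be moved from the power into the linear factor.\<close>

lemma veronese_tangent_eq_range_qvec:
  assumes v: "v \<noteq> 0" and d: "d > 0"
  shows "veronese_tangent d (linform v ^ d) = range (qvec d v)"
proof
  define s where "s = sqrt (real d) * norm v powi (1 - int d)"
  have s: "s \<noteq> 0" using v d by (simp add: s_def)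
  show "range (qvec d v) \<subseteq> veronese_tangent d (linform v ^ d)"
  proof
    fix q assume "q \<in> range (qvec d v)"
    then obtain u where "q = s *\<^sub>R (linform u * linform v ^ (d - 1))"
      by (auto simp: qvec_def s_def)
    then have "q = linform (s *\<^sub>R u) * linform v ^ (d - 1)"
      by (simp add: linear_cmul[OF linear_linform] scaleR_mult_poly)
    with v show "q \<in> veronese_tangent d (linform v ^ d)"
      by (auto simp: veronese_tangent_def)
  qed
  show "veronese_tangent d (linform v ^ d) \<subseteq> range (qvec d v)"
  proof
    fix q assume "q \<in> veronese_tangent d (linform v ^ d)"
    then obtain u w where q: "q = linform u * linform w ^ (d - 1)"
      and eq: "linform v ^ d = linform w ^ d"
      by (auto simp: veronese_tangent_def)
    obtain c where "w = c *s v"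
      using linform_power_eq_imp_scale[OF v d eq] .
    then have "linform w ^ (d - 1) = Poly_Mapping.single 0 (c ^ (d - 1)) * linform v ^ (d - 1)"
    proof -
      have "Poly_Mapping.single 0 c ^ m = (Poly_Mapping.single 0 (c ^ m) :: 'a cpoly)" for m
        by (induction m) (simp_all add: mult_single)
      with \<open>w = c *s v\<close> show ?thesis by (simp add: linform_scale power_mult_distrib)
    qed
    then have "q = linform (c ^ (d - 1) *s u) * linform v ^ (d - 1)"
      by (simp add: q linform_scale mult_ac)
    also have "\<dots> = qvec d v (inverse s *\<^sub>R (c ^ (d - 1) *s u))"
      using s by (simp add: linear_cmul[OF linear_qvec]) (simp add: qvec_def flip: s_def)
    finally show "q \<in> range (qvec d v)" by blast
  qed
qed

text \<open>The two factors \<open>sqrt d\<close> in the normalisation of \<open>qvec\<close> compensate the \<open>1 / d\<close> of the reproducing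
  property. These are the entries of \<open>H\<close>.\<close>

lemma apolar_Re_qvec:
  assumes "d > 0"
  shows "apolar_Re d (qvec d v u) (qvec d v' u') =
    norm v powi (1 - int d) * norm v' powi (1 - int d) *
      (Re (herm u u' * herm v v' ^ (d - 1))
        + real (d - 1) * Re (herm u v' * herm v u' * herm v v' ^ (d - 2)))"
proof -
  from assms obtain m where m: "d = Suc m" using gr0_conv_Suc by blast
  define X where "X = herm u u' * herm v v' ^ m + of_nat m * (herm u v' * herm v u' * herm v v' ^ (m - 1))"
  have "apolar_Re d (qvec d v u) (qvec d v' u') =
      (sqrt (real d) * norm v powi (1 - int d)) * (sqrt (real d) * norm v' powi (1 - int d)) *
      apolar_Re d (linform u * linform v ^ m) (linform u' * linform v' ^ m)"
    unfolding qvec_def bilinear_lmul[OF bilinear_apolar_Re] bilinear_rmul[OF bilinear_apolar_Re]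
    by (simp add: m mult.assoc)
  also have "\<dots> = (sqrt (real d) * sqrt (real d)) * (norm v powi (1 - int d) * norm v' powi (1 - int d)) *
      (Re X / real d)"
    unfolding apolar_Re_def m apolar_linform_mult_powers X_def[symmetric]
    by (simp only: Re_divide_of_nat mult_ac)
  also have "\<dots> = norm v powi (1 - int d) * norm v' powi (1 - int d) * Re X"
    using assms by simp
  finally show ?thesis
    by (simp add: X_def m)
qed

text \<open>Since \<open>herm v v\<close> is the square of the norm, the normalisation of \<open>qvec\<close> removes all its powers,
  except that the second summand lacks one factor; hence the division in \<open>inner_at\<close>.\<close>

lemma apolar_Re_qvec_same:
  assumes v: "v \<noteq> 0" and d: "d \<ge> 2"
  shows "apolar_Re d (qvec d v u) (qvec d v u') = inner_at d v u u'"
proof -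
  from d obtain m where m: "d = m + 2" using nat_le_iff_add[of 2 d] by (auto simp: add.commute)
  define N where "N = (norm v)\<^sup>2"
  have N: "N \<noteq> 0" using v by (simp add: N_def)
  have pow: "norm v powi (1 - int d) * norm v powi (1 - int d) = 1 / N ^ (m + 1)"
  proof -
    have "1 - int d = - int (m + 1)" by (simp add: m)
    then have "norm v powi (1 - int d) = 1 / norm v ^ (m + 1)"
      by (simp only: power_int_minus_divide power_int_of_nat)
    then have "norm v powi (1 - int d) * norm v powi (1 - int d) = 1 / (norm v * norm v) ^ (m + 1)"
      by (simp only: power_mult_distrib times_divide_times_eq mult_1)
    then show ?thesis by (simp only: N_def power2_eq_square)
  qed
  define c where "c = real (d - 1)"
  define B where "B = herm u v * herm v u'"
  have "Re (herm u u' * herm v v ^ (d - 1)) = N ^ (m + 1) * Re (herm u u')"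
       "Re (B * herm v v ^ (d - 2)) = N ^ m * Re B"
    by (simp_all add: herm_self m N_def[symmetric] flip: of_real_power of_real_mult)
  moreover have "1 / N ^ (m + 1) * (N ^ (m + 1) * x + c * (N ^ m * z)) = x + c * z / N" for x z
    using N by (simp add: field_simps)
  moreover have "d > 0" using d by simp
  ultimately have "apolar_Re d (qvec d v u) (qvec d v u') = Re (herm u u') + c * Re B / N"
    unfolding B_def by (simp only: apolar_Re_qvec pow c_def[symmetric])
  also have "\<dots> = inner_at d v u u'"
    by (simp add: inner_at_def N_def B_def c_def Re_divide_of_real flip: of_real_power)
  finally show ?thesis .
qed

section \<open>Enumeration of pairs\<close>

text \<open>Positions are counted from \<open>1\<close>, so quotient and remainder are those of \<open>k - 1\<close>.\<close>

lemma pair_index_obtain: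
  fixes N r k :: nat
  assumes "k \<in> {1..N * r}"
  obtains i j where "i \<in> {1..r}" "j \<in> {1..N}" "k = N * (i - 1) + j"
proof
  from assms have N: "N > 0" and k: "k - 1 < r * N"
    by (auto intro: Nat.gr0I simp: mult.commute)
  show "(k - 1) div N + 1 \<in> {1..r}"
    using less_mult_imp_div_less[OF k] by simp
  show "(k - 1) mod N + 1 \<in> {1..N}"
    using mod_less_divisor[OF N, of "k - 1"] by (simp add: Suc_le_eq)
  have "N * ((k - 1) div N) + (k - 1) mod N = k - 1"
    by (rule mult_div_mod_eq)
  with assms show "k = N * ((k - 1) div N + 1 - 1) + ((k - 1) mod N + 1)"
    by simp
qed

lemma pair_index_in:
  fixes N r i j :: nat
  assumes "i \<in> {1..r}" "j \<in> {1..N}"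
  shows "N * (i - 1) + j \<in> {1..N * r}"
proof -
  have "N * (i - 1) + j \<le> N * (i - 1) + N * 1" using assms by simp
  also have "\<dots> = N * i" using assms by (cases i) simp_all
  also have "\<dots> \<le> N * r" using assms by simp
  finally show ?thesis using assms by simp
qed

lemma pair_index_inject:
  fixes N i j i' j' :: nat
  assumes "i \<ge> 1" "i' \<ge> 1" "j \<in> {1..N}" "j' \<in> {1..N}"
    and eq: "N * (i - 1) + j = N * (i' - 1) + j'"
  shows "i = i' \<and> j = j'"
proof -
  have *: "N * (a - 1) + b - 1 = (b - 1) + (a - 1) * N" "b - 1 < N" if "b \<in> {1..N}" for a b
    using that by (auto simp: mult.commute)
  have div: "(N * (a - 1) + b - 1) div N = a - 1" if "b \<in> {1..N}" for a b
    using *[OF that] by simp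
  have "i - 1 = i' - 1"
    using div[OF assms(3), of i] div[OF assms(4), of i'] eq by simp
  with assms show ?thesis by simp
qed

section \<open>The basis of the tangent space of the product\<close>

lemma linear_single: "linear (Poly_Mapping.single i :: 'b::real_vector \<Rightarrow> 'a \<Rightarrow>\<^sub>0 'b)"
proof (rule linearI)
  show "Poly_Mapping.single i (c *\<^sub>R x) = c *\<^sub>R Poly_Mapping.single i x" for c and x :: 'b
    by (intro poly_mapping_eqI) (simp add: lookup_scaleR lookup_single when_def)
qed (rule single_add)

lemma subspace_prod_tangent:
  assumes "\<And>i. i \<in> {1..r} \<Longrightarrow> subspace (veronese_tangent d (Poly_Mapping.lookup y i))"
  shows "subspace (prod_tangent d r y)"
proof (rule subspaceI)
  show "0 \<in> prod_tangent d r y"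
    using assms by (auto simp: prod_tangent_def intro: subspace_0)
  show "\<eta> + \<xi> \<in> prod_tangent d r y"
    if "\<eta> \<in> prod_tangent d r y" "\<xi> \<in> prod_tangent d r y" for \<eta> \<xi>
    using that keys_add[of \<eta> \<xi>] assms
    unfolding prod_tangent_def by (simp add: lookup_add subspace_add) blast
  show "c *\<^sub>R \<eta> \<in> prod_tangent d r y" if "\<eta> \<in> prod_tangent d r y" for c \<eta>
  proof -
    have "Poly_Mapping.keys (c *\<^sub>R \<eta>) \<subseteq> Poly_Mapping.keys \<eta>"
      by (auto simp: in_keys_iff lookup_scaleR)
    with that assms show ?thesis
      unfolding prod_tangent_def by (simp add: lookup_scaleR subspace_scale) blast
  qed
qed

lemma span_prod_tangent:
  assumes tan: "\<And>i. i \<in> {1..r} \<Longrightarrow> span (B i) = veronese_tangent d (Poly_Mapping.lookup y i)"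
  shows "span (\<Union>i\<in>{1..r}. Poly_Mapping.single i ` B i) = prod_tangent d r y"
    (is "span ?S = _")
proof
  have sub: "subspace (veronese_tangent d (Poly_Mapping.lookup y i))" if "i \<in> {1..r}" for i
    using tan[OF that] subspace_span by metis
  have "?S \<subseteq> prod_tangent d r y"
  proof clarify
    fix i x assume i: "i \<in> {1..r}" and "x \<in> B i"
    then have "x \<in> veronese_tangent d (Poly_Mapping.lookup y i)"
      using tan span_base by blast
    then show "Poly_Mapping.single i x \<in> prod_tangent d r y"
      using i subspace_0[OF sub] by (auto simp: prod_tangent_def lookup_single when_def)
  qed
  then show "span ?S \<subseteq> prod_tangent d r y"
    using subspace_prod_tangent[OF sub] by (rule span_minimal)
  show "prod_tangent d r y \<subseteq> span ?S"
  proof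
    fix \<eta> assume \<eta>: "\<eta> \<in> prod_tangent d r y"
    have "Poly_Mapping.single i (Poly_Mapping.lookup \<eta> i) \<in> span ?S" if i: "i \<in> {1..r}" for i
    proof -
      have "Poly_Mapping.lookup \<eta> i \<in> span (B i)"
        using \<eta> i tan by (simp add: prod_tangent_def)
      then have "Poly_Mapping.single i (Poly_Mapping.lookup \<eta> i) \<in> span (Poly_Mapping.single i ` B i)"
        unfolding linear_span_image[OF linear_single] by (rule imageI)
      also have "\<dots> \<subseteq> span ?S"
        using i by (intro span_mono) blast
      finally show ?thesis .
    qed
    then have "(\<Sum>i=1..r. Poly_Mapping.single i (Poly_Mapping.lookup \<eta> i)) \<in> span ?S"
      by (rule span_sum)
    moreover have "\<eta> = (\<Sum>i\<in>Poly_Mapping.keys \<eta>. Poly_Mapping.single i (Poly_Mapping.lookup \<eta> i))"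
      by (rule poly_mapping_sum_single)
    moreover have "\<dots> = (\<Sum>i=1..r. Poly_Mapping.single i (Poly_Mapping.lookup \<eta> i))"
      using \<eta> by (intro sum.mono_neutral_left) (auto simp: prod_tangent_def in_keys_iff)
    ultimately show "\<eta> \<in> span ?S" by simp
  qed
qed

text \<open>These are the entries of \<open>G\<close>. A power \<open>linform (v k) ^ d\<close> is \<open>linform (v k)\<close> times
  \<open>linform (v k) ^ (d - 1)\<close>; the two summands in the product of such forms are then
  proportional with factor \<open>d - 1\<close>, and together cancel the \<open>1 / d\<close>.\<close>

lemma apolar_Re_qvec_resid:
  fixes p :: "('n::finite) cpoly" and u w :: "complex ^ 'n"
  assumes d: "d > 0" and p: "p \<in> forms d"
    and yv: "\<And>i. i \<in> {1..r} \<Longrightarrow> Poly_Mapping.lookup y i = linform (v i) ^ d"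
  shows "apolar_Re d (qvec d w u) (resid r p y) =
    sqrt (inverse (real d)) * norm w powi (1 - int d) *
      (real d * (\<Sum>k=1..r. Re (herm u (v k) * herm w (v k) ^ (d - 1)))
        - Re (herm u (poly_grad p (cnj_vec w))))"
proof -
  from d obtain m where m: "d = Suc m" using gr0_conv_Suc by blast
  define f where "f = linform u * linform w ^ m"
  have lin: "linear (apolar_Re d f)"
    by (rule bilinear_apolar_Re[unfolded bilinear_def, THEN conjunct1, rule_format])
  have y: "apolar_Re d f (Poly_Mapping.lookup y k) = Re (herm u (v k) * herm w (v k) ^ m)"
    if "k \<in> {1..r}" for k
  proof -
    have "apolar d f (Poly_Mapping.lookup y k) =
        of_nat (Suc m) * (herm u (v k) * herm w (v k) ^ m) / of_nat (Suc m)"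
      unfolding yv[OF that] f_def m power_Suc apolar_linform_mult_powers
      by (cases m) (simp_all add: algebra_simps)
    then show ?thesis
      by (simp add: apolar_Re_def del: of_nat_Suc)
  qed
  have p': "apolar_Re d f p = Re (herm u (poly_grad p (cnj_vec w))) / real d"
    using p unfolding apolar_Re_def f_def m
    by (simp add: apolar_linform_mult_power Re_divide_of_nat del: of_nat_Suc)
  have res: "apolar_Re d f (resid r p y) =
      (\<Sum>k=1..r. Re (herm u (v k) * herm w (v k) ^ m))
        - Re (herm u (poly_grad p (cnj_vec w))) / real d"
    by (simp add: resid_def linear_diff[OF lin] linear_sum[OF lin] y p')
  have "apolar_Re d (qvec d w u) (resid r p y) =
      sqrt (real d) * norm w powi (1 - int d) * apolar_Re d f (resid r p y)"
    unfolding qvec_def bilinear_lmul[OF bilinear_apolar_Re] f_def by (simp add: m)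
  also have "sqrt (real d) = sqrt (inverse (real d)) * real d"
    using d by (simp add: inverse_eq_divide real_sqrt_divide real_div_sqrt)
  also have "\<dots> * norm w powi (1 - int d) * apolar_Re d f (resid r p y) =
      sqrt (inverse (real d)) * norm w powi (1 - int d) * (real d * apolar_Re d f (resid r p y))"
    by (simp only: mult_ac)
  also have "real d * apolar_Re d f (resid r p y) =
      real d * (\<Sum>k=1..r. Re (herm u (v k) * herm w (v k) ^ (d - 1)))
        - Re (herm u (poly_grad p (cnj_vec w)))"
    using d unfolding res by (simp only: right_diff_distrib) (simp add: m)
  finally show ?thesis .
qed

theorem proposition4p9:
  fixes d r n :: nat
    and p :: "('n::finite) cpoly"
    and y :: "nat \<Rightarrow>\<^sub>0 'n cpoly"
    and v :: "nat \<Rightarrow> complex ^ 'n"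
    and u :: "nat \<Rightarrow> nat \<Rightarrow> complex ^ 'n"
    and Q :: "nat \<Rightarrow> (nat \<Rightarrow>\<^sub>0 'n cpoly)"
    and G :: "nat \<Rightarrow> real"
    and H :: "nat \<Rightarrow> nat \<Rightarrow> real"
  assumes n: "n = CARD('n)"
    and d: "d > 2"
    and r: "r < generic_rank d n"
    and p: "p \<in> forms d"
    and y: "y \<in> veronese_prod d r"
    and v: "\<And>i. i \<in> {1..r} \<Longrightarrow> v i \<noteq> 0"
    and yv: "\<And>i. i \<in> {1..r} \<Longrightarrow> Poly_Mapping.lookup y i = linform (v i) ^ d"
    and u: "\<And>i. i \<in> {1..r} \<Longrightarrow> orthonormal_basis UNIV (inner_at d (v i)) (2 * n) (u i)"
    and u1: "\<And>i. i \<in> {1..r} \<Longrightarrow> u i 1 = (1 / (sqrt (real d) * norm (v i))) *\<^sub>R v i"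
    and Q: "\<And>i j. i \<in> {1..r} \<Longrightarrow> j \<in> {1..2 * n} \<Longrightarrow>
      Q (2 * n * (i - 1) + j) = Poly_Mapping.single i (qvec d (v i) (u i j))"
    and G: "\<And>i j. i \<in> {1..r} \<Longrightarrow> j \<in> {1..2 * n} \<Longrightarrow>
      G (2 * n * (i - 1) + j) =
        sqrt (inverse (real d)) * norm (v i) powi (1 - int d) *
        (real d * (\<Sum>k=1..r. Re (herm (u i j) (v k) * herm (v i) (v k) ^ (d - 1)))
          - Re (herm (u i j) (poly_grad p (cnj_vec (v i)))))"
    and H: "\<And>i j i' j'. i \<in> {1..r} \<Longrightarrow> j \<in> {1..2 * n} \<Longrightarrow> i' \<in> {1..r} \<Longrightarrow> j' \<in> {1..2 * n} \<Longrightarrow>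
      H (2 * n * (i - 1) + j) (2 * n * (i' - 1) + j') =
        norm (v i) powi (1 - int d) * norm (v i') powi (1 - int d) *
        (Re (herm (u i j) (u i' j') * herm (v i) (v i') ^ (d - 1))
          + real (d - 1) *
            Re (herm (u i j) (v i') * herm (v i) (u i' j') * herm (v i) (v i') ^ (d - 2)))"
  shows "orthonormal_basis (prod_tangent d r y) (prod_inner d r) (2 * n * r) Q
    \<and> (\<forall>\<eta>t :: nat \<Rightarrow> real.
          Dresid_adj d r p y (Dresid r p y (\<Sum>k=1..2 * n * r. \<eta>t k *\<^sub>R Q k)) =
            (\<Sum>k=1..2 * n * r. (\<Sum>k'=1..2 * n * r. H k k' * \<eta>t k') *\<^sub>R Q k))
    \<and> Dresid_adj d r p y (resid r p y) = (\<Sum>k=1..2 * n * r. G k *\<^sub>R Q k)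
    \<and> (\<forall>\<eta>t :: nat \<Rightarrow> real.
          gauss_newton_eq d r p y (\<Sum>k=1..2 * n * r. \<eta>t k *\<^sub>R Q k) \<longleftrightarrow>
            (\<forall>k\<in>{1..2 * n * r}. (\<Sum>k'=1..2 * n * r. H k k' * \<eta>t k') = - G k))"
proof -
  let ?I = "{1..2 * n * r}"
  let ?D = "Dresid r p y" and ?A = "Dresid_adj d r p y"
  have orth: "prod_inner d r (Q k) (Q l) = (if k = l then 1 else 0)" if k: "k \<in> ?I" and l: "l \<in> ?I" for k l
  proof -
    obtain i j where ij: "i \<in> {1..r}" "j \<in> {1..2 * n}" "k = 2 * n * (i - 1) + j"
      using pair_index_obtain[OF k] .
    obtain i' j' where ij': "i' \<in> {1..r}" "j' \<in> {1..2 * n}" "l = 2 * n * (i' - 1) + j'"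
      using pair_index_obtain[OF l] .
    have "k = l \<longleftrightarrow> i = i' \<and> j = j'"
      using ij ij' pair_index_inject[of i i' j "2 * n" j'] by auto
    moreover have "apolar_Re d (qvec d (v i) (u i j)) (qvec d (v i) (u i j')) = (if j = j' then 1 else 0)"
      using u[OF ij(1)] ij(2) ij'(2) v[OF ij(1)] d
      by (simp add: apolar_Re_qvec_same orthonormal_basis_def)
    ultimately show ?thesis
      unfolding ij(3) ij'(3) Q[OF ij(1,2)] Q[OF ij'(1,2)] prod_inner_single[OF ij(1) ij'(1)] by auto
  qed
  have img: "Q ` ?I = (\<Union>i\<in>{1..r}. Poly_Mapping.single i ` qvec d (v i) ` u i ` {1..2 * n})"
  proof (intro equalityI subsetI)
    fix \<xi> assume "\<xi> \<in> Q ` ?I"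
    then obtain k where "k \<in> ?I" "\<xi> = Q k" by blast
    then obtain i j where "i \<in> {1..r}" "j \<in> {1..2 * n}" "\<xi> = Q (2 * n * (i - 1) + j)"
      using pair_index_obtain by metis
    then show "\<xi> \<in> (\<Union>i\<in>{1..r}. Poly_Mapping.single i ` qvec d (v i) ` u i ` {1..2 * n})"
      using Q by blast
  next
    fix \<xi> assume "\<xi> \<in> (\<Union>i\<in>{1..r}. Poly_Mapping.single i ` qvec d (v i) ` u i ` {1..2 * n})"
    then obtain i j where "i \<in> {1..r}" "j \<in> {1..2 * n}" "\<xi> = Q (2 * n * (i - 1) + j)"
      using Q by auto
    then show "\<xi> \<in> Q ` ?I"
      using pair_index_in by blast
  qed
  have "span (Q ` ?I) = prod_tangent d r y"
    unfolding img
  proof (rule span_prod_tangent)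
    fix i assume i: "i \<in> {1..r}"
    have "span (u i ` {1..2 * n}) = UNIV"
      using u[OF i] by (simp add: orthonormal_basis_def)
    then show "span (qvec d (v i) ` u i ` {1..2 * n}) = veronese_tangent d (Poly_Mapping.lookup y i)"
      using d v[OF i] by (simp add: yv[OF i] linear_span_image[OF linear_qvec] veronese_tangent_eq_range_qvec)
  qed
  with orth have ob: "orthonormal_basis (prod_tangent d r y) (prod_inner d r) (2 * n * r) Q"
    by (intro orthonormal_basisI bilinear_prod_inner)
  have linD: "linear ?D"
    unfolding Dresid_apply[abs_def]
    by (intro linear_compose_sum ballI bounded_linear.linear[OF bounded_linear_lookup])
  have A: "?A w = (\<Sum>k\<in>?I. apolar_Re d (?D (Q k)) w *\<^sub>R Q k)" for w
    unfolding Dresid_adj_def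
    by (rule adjoint_on_orthonormal_basis[OF bilinear_prod_inner ob bilinear_apolar_Re linD])
  have DQ: "?D (Q (2 * n * (i - 1) + j)) = qvec d (v i) (u i j)"
    if "i \<in> {1..r}" "j \<in> {1..2 * n}" for i j
  proof -
    have "(\<Sum>l=1..r. Poly_Mapping.lookup (Poly_Mapping.single i (qvec d (v i) (u i j))) l) =
        (\<Sum>l=1..r. if l = i then qvec d (v i) (u i j) else 0)"
      by (rule sum.cong) (auto simp: lookup_single when_def)
    then show ?thesis
      using that(1) unfolding Q[OF that] Dresid_apply by simp
  qed
  have HQ: "apolar_Re d (?D (Q k)) (?D (Q k')) = H k k'" if k: "k \<in> ?I" and k': "k' \<in> ?I" for k k'
  proof -
    obtain i j where ij: "i \<in> {1..r}" "j \<in> {1..2 * n}" "k = 2 * n * (i - 1) + j"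
      using pair_index_obtain[OF k] .
    obtain i' j' where ij': "i' \<in> {1..r}" "j' \<in> {1..2 * n}" "k' = 2 * n * (i' - 1) + j'"
      using pair_index_obtain[OF k'] .
    have "0 < d" using d by simp
    then show ?thesis
      unfolding ij(3) ij'(3) DQ[OF ij(1,2)] DQ[OF ij'(1,2)] H[OF ij(1,2) ij'(1,2)]
      by (rule apolar_Re_qvec)
  qed
  have GQ: "apolar_Re d (?D (Q k)) (resid r p y) = G k" if k: "k \<in> ?I" for k
  proof -
    obtain i j where ij: "i \<in> {1..r}" "j \<in> {1..2 * n}" "k = 2 * n * (i - 1) + j"
      using pair_index_obtain[OF k] .
    have "0 < d" using d by simp
    then show ?thesis
      unfolding ij(3) DQ[OF ij(1,2)] G[OF ij(1,2)]
      using p yv by (rule apolar_Re_qvec_resid)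
  qed
  have AD: "?A (?D (\<Sum>k\<in>?I. \<eta>t k *\<^sub>R Q k)) = (\<Sum>k\<in>?I. (\<Sum>k'\<in>?I. H k k' * \<eta>t k') *\<^sub>R Q k)"
    for \<eta>t :: "nat \<Rightarrow> real"
  proof -
    have "?D (\<Sum>k\<in>?I. \<eta>t k *\<^sub>R Q k) = (\<Sum>k\<in>?I. \<eta>t k *\<^sub>R ?D (Q k))"
      by (simp add: linear_sum[OF linD] linear_cmul[OF linD])
    then have "apolar_Re d (?D (Q k)) (?D (\<Sum>k\<in>?I. \<eta>t k *\<^sub>R Q k)) = (\<Sum>k'\<in>?I. H k k' * \<eta>t k')"
      if "k \<in> ?I" for k
      using that by (simp add: bilinear_sum_right[OF bilinear_apolar_Re] HQ mult.commute cong: sum.cong_simp)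
    then show ?thesis
      unfolding A by simp
  qed
  have AG: "?A (resid r p y) = (\<Sum>k\<in>?I. G k *\<^sub>R Q k)"
    unfolding A by (simp add: GQ)
  have "gauss_newton_eq d r p y (\<Sum>k\<in>?I. \<eta>t k *\<^sub>R Q k) \<longleftrightarrow>
      (\<forall>k\<in>?I. (\<Sum>k'\<in>?I. H k k' * \<eta>t k') = - G k)" for \<eta>t :: "nat \<Rightarrow> real"
  proof -
    have "(\<Sum>k\<in>?I. \<eta>t k *\<^sub>R Q k) \<in> span (Q ` ?I)"
      by (intro span_sum span_scale span_base imageI)
    then have "(\<Sum>k\<in>?I. \<eta>t k *\<^sub>R Q k) \<in> prod_tangent d r y"
      using ob by (simp add: orthonormal_basis_def)
    then have "gauss_newton_eq d r p y (\<Sum>k\<in>?I. \<eta>t k *\<^sub>R Q k) \<longleftrightarrow>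
        (\<Sum>k\<in>?I. (\<Sum>k'\<in>?I. H k k' * \<eta>t k') *\<^sub>R Q k) = (\<Sum>k\<in>?I. (- G k) *\<^sub>R Q k)"
      unfolding gauss_newton_eq_def AD AG by (simp add: sum_negf)
    also have "\<dots> \<longleftrightarrow> (\<forall>k\<in>?I. (\<Sum>k'\<in>?I. H k k' * \<eta>t k') = - G k)"
    proof
      assume eq: "(\<Sum>k\<in>?I. (\<Sum>k'\<in>?I. H k k' * \<eta>t k') *\<^sub>R Q k) = (\<Sum>k\<in>?I. (- G k) *\<^sub>R Q k)"
      show "\<forall>k\<in>?I. (\<Sum>k'\<in>?I. H k k' * \<eta>t k') = - G k"
      proof
        fix k assume k: "k \<in> ?I"
        have coeff: "prod_inner d r (Q k) (\<Sum>l\<in>?I. c l *\<^sub>R Q l) = c k" for c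
          using bilinear_prod_inner orth k by (rule orthonormal_coeff)
        from arg_cong[OF eq, of "prod_inner d r (Q k)"]
        show "(\<Sum>k'\<in>?I. H k k' * \<eta>t k') = - G k"
          by (simp only: coeff)
      qed
    qed simp
    finally show ?thesis .
  qed
  with ob AD AG show ?thesis by blast
qed

end
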